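(* There exist universal constants $C,c>0$, and for every $\varepsilon\in(0,1)$ a constant $C_\varepsilon>0$ depending only on $\varepsilon$, such that for every integer $k\ge1$, if $Y\sim\chi^2_k$ and $X=Y-k$, then $$\mathbb{P}(X\ge x)\ge c\exp\left(-C\left(x\wedge\frac{x^2}{k}\right)\right),\qquad\forall\,x>0;$$ $$\mathbb{P}(X\le-x)\ge c\exp\left(-\frac{C_\varepsilon x^2}{k}\right),\qquad\forall\,0<x<(1-\varepsilon)k;$$ and $\mathbb{P}(X\le-x)=0$ for all $x\ge k$.
   Context: $\chi^2_k$ is the chi-square distribution with $k$ degrees of freedom. $x\wedge y$ denotes the minimum of $x$ and $y$. *)

theory Defs
  imports "HOL-Probability.Probability"
begin

abbreviation std_normal_measure :: "real measure" where
  "std_normal_measure \<equiv> density lborel (\<lambda>x. ennreal (std_normal_density x))"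

definition chi_square :: "nat \<Rightarrow> real measure" where
  "chi_square k = distr (\<Pi>\<^sub>M i\<in>{..<k}. std_normal_measure) borel (\<lambda>z. \<Sum>i<k. (z i)\<^sup>2)"

lemma measurable_sum_squares:
  "(\<lambda>z. \<Sum>i<k. (z i)\<^sup>2) \<in> borel_measurable (\<Pi>\<^sub>M i\<in>{..<k}. std_normal_measure)"
  by (intro borel_measurable_sum borel_measurable_power) (auto intro!: measurable_component_singleton[THEN measurable_compose])

lemma sets_chi_square [simp, measurable_cong]: "sets (chi_square k) = sets borel"
  and space_chi_square [simp]: "space (chi_square k) = UNIV"
  by (simp_all add: chi_square_def)

lemma prob_space_chi_square: "prob_space (chi_square k)"
proof -
  interpret N: prob_space std_normal_measure
    by (rule prob_space_normal_density) simp
  interpret P: product_prob_space "\<lambda>_::nat. std_normal_measure" "{..<k}"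
    by unfold_locales
  show ?thesis
    unfolding chi_square_def by (rule P.prob_space_distr) (rule measurable_sum_squares)
qed

text \<open>
  Probabilities of events of a random variable \<open>Y\<close> depend only on its law. So a bound on
  \<^term>\<open>chi_square k\<close> holds, with the same constants, for a chi-square variable on any
  probability space. In particular it holds for a sum of squares of independent standard normal
  variables, by the two lemmas below. In HOL an existential statement about constants cannot
  quantify over the type of the sample space after the constants, which is why bounds with
  universal constants are best stated for the law.
\<close>

lemma prob_eq_law:
  assumes "Y \<in> borel_measurable M" "distr M borel Y = chi_square k"
    and "{y. P y} \<in> sets borel"
  shows "\<P>(\<omega> in M. P (Y \<omega>)) = \<P>(y in chi_square k. P y)"
proof -
  have "\<P>(y in chi_square k. P y) = measure (distr M borel Y) {y. P y}"
    using assms(2) by simp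
  also have "\<dots> = \<P>(\<omega> in M. P (Y \<omega>))"
    using assms(1,3) by (subst measure_distr) (auto intro!: arg_cong[where f = "measure M"])
  finally show ?thesis by simp
qed

lemma (in prob_space) distr_sum_squares_std_normal:
  assumes "k \<ge> 1" and "indep_vars (\<lambda>_. borel) Z {..<k}"
    and Z: "\<And>i. i < k \<Longrightarrow> distributed M lborel (Z i) std_normal_density"
  shows "distr M borel (\<lambda>\<omega>. \<Sum>i<k. (Z i \<omega>)\<^sup>2) = chi_square k"
proof -
  have rv: "random_variable borel (Z i)" if "i < k" for i
    using Z[OF that] by (auto dest: distributed_measurable)
  have law: "distr M borel (Z i) = std_normal_measure" if "i < k" for i
    using distributed_distr_eq_density[OF Z[OF that]] by (metis (no_types, lifting) distr_cong sets_lborel)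
  have "distr M (\<Pi>\<^sub>M i\<in>{..<k}. borel) (\<lambda>\<omega>. \<lambda>i\<in>{..<k}. Z i \<omega>)
      = (\<Pi>\<^sub>M i\<in>{..<k}. distr M borel (Z i))"
    using assms rv by (subst indep_vars_iff_distr_eq_PiM'[symmetric]) (auto simp: lessThan_empty_iff)
  also have "\<dots> = (\<Pi>\<^sub>M i\<in>{..<k}. std_normal_measure)"
    by (intro PiM_cong) (auto simp: law)
  finally have eq: "(\<Pi>\<^sub>M i\<in>{..<k}. std_normal_measure)
      = distr M (\<Pi>\<^sub>M i\<in>{..<k}. borel) (\<lambda>\<omega>. \<lambda>i\<in>{..<k}. Z i \<omega>)" by simp
  have m1: "(\<lambda>\<omega>. \<lambda>i\<in>{..<k}. Z i \<omega>) \<in> measurable M (\<Pi>\<^sub>M i\<in>{..<k}. borel)"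
    using rv by (intro measurable_restrict) auto
  have m2: "(\<lambda>z. \<Sum>i<k. (z i)\<^sup>2) \<in> borel_measurable (\<Pi>\<^sub>M i\<in>{..<k}. (borel :: real measure))"
    by (intro borel_measurable_sum borel_measurable_power) auto
  show ?thesis
    unfolding chi_square_def eq distr_distr[OF m2 m1] by (intro distr_cong) (auto simp: o_def)
qed

end

theory Submission
  imports Defs
begin

text \<open>
  The proof transports typical values to the tail by scaling. Let \<open>Y\<close> be the squared norm of a
  standard Gaussian vector in dimension \<open>k\<close>. Scaling the vector by \<open>sqrt s\<close> changes its law by a
  density that depends on the squared norm only, which gives for every \<open>s > 0\<close> and every Borel set
  \<open>A\<close> of reals that the probability of \<open>Y \<in> s * A\<close> is the expectation of
  \<open>exp (k / 2 * ln s - (s - 1) * Y / 2)\<close> over the event \<open>Y \<in> A\<close> (lemma \<open>chi_square_scale\<close>).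

  To reach \<open>k + x\<close> or \<open>k - x\<close>, take \<open>s = 1 + x / k\<close> or \<open>s = 1 - x / k\<close>, and let \<open>A\<close> be the interval of
  length \<open>8 * sqrt k\<close> that starts at \<open>k\<close>, respectively ends there. At \<open>Y = k\<close> the terms of the
  exponent that are linear in \<open>x\<close> cancel. There remain a quadratic term, since \<open>ln (1 + u)\<close> is \<open>u\<close> up to \<open>u\<^sup>2\<close> for \<open>u\<close> bounded away from
  \<open>- 1\<close> (and up to \<open>u\<close> for large \<open>u\<close>, which yields the linear regime of the upper tail), and a term of
  order \<open>x / sqrt k\<close> due to the length of \<open>A\<close>; the latter is at most a constant plus a multiple of
  the claimed exponent.

  It remains to see that \<open>A\<close> has probability bounded below uniformly in \<open>k\<close>. This follows from the
  first, second and fourth moments of \<open>Y - k\<close> by integrating a quartic polynomial that is positive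
  only on \<open>A\<close> (lemmas \<open>chi_square_moments\<close>, \<open>prob_one_sided_window\<close> and \<open>chi_square_window\<close>).

  Finally, \<open>Y \<le> 0\<close> has probability zero, because scaling fixes the origin and would otherwise
  multiply its mass.
\<close>

section \<open>Scaling as a change of measure\<close>

lemma std_normal_scale:
  assumes "\<sigma> > 0"
  shows "distr std_normal_measure borel (\<lambda>z. z / \<sigma>)
    = density std_normal_measure (\<lambda>z. ennreal (\<sigma> * exp (- (\<sigma>\<^sup>2 - 1) * z\<^sup>2 / 2)))"
proof (rule measure_eqI)
  fix A assume "A \<in> sets (distr std_normal_measure borel (\<lambda>z. z / \<sigma>))"
  then have [measurable]: "A \<in> sets borel" by simp
  (* the Jacobian sigma of z = sigma * x is the factor on the left *)
  have pull: "ennreal \<sigma> * ennreal (std_normal_density (\<sigma> * x))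
      = ennreal (std_normal_density x) * ennreal (\<sigma> * exp (- (\<sigma>\<^sup>2 - 1) * x\<^sup>2 / 2))" for x
    using assms
    by (simp add: std_normal_density_def ennreal_mult'[symmetric] exp_add[symmetric] power_mult_distrib field_simps)
  have "emeasure (distr std_normal_measure borel (\<lambda>z. z / \<sigma>)) A
      = (\<integral>\<^sup>+z. indicator A (z / \<sigma>) \<partial>std_normal_measure)"
    by (simp flip: nn_integral_indicator add: nn_integral_distr)
  also have "\<dots> = (\<integral>\<^sup>+z. ennreal (std_normal_density z) * indicator A (z / \<sigma>) \<partial>lborel)"
    by (simp add: nn_integral_density)
  also have "\<dots> = \<sigma> * (\<integral>\<^sup>+z. ennreal (std_normal_density (\<sigma> * z)) * indicator A z \<partial>lborel)"
    using assms by (subst nn_integral_real_affine[of _ \<sigma> 0]) auto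
  also have "\<dots> = (\<integral>\<^sup>+z. ennreal (std_normal_density z)
      * (ennreal (\<sigma> * exp (- (\<sigma>\<^sup>2 - 1) * z\<^sup>2 / 2)) * indicator A z) \<partial>lborel)"
    by (simp flip: nn_integral_cmult mult.assoc add: pull)
  finally show "emeasure (distr std_normal_measure borel (\<lambda>z. z / \<sigma>)) A
      = emeasure (density std_normal_measure (\<lambda>z. ennreal (\<sigma> * exp (- (\<sigma>\<^sup>2 - 1) * z\<^sup>2 / 2)))) A"
    by (simp add: emeasure_density nn_integral_density)
qed simp

lemma PiM_density:
  fixes N :: "'i \<Rightarrow> 'a measure"
  assumes I: "finite I" and N: "\<And>i. prob_space (N i)"
    and [measurable]: "\<And>i. g i \<in> borel_measurable (N i)"
    and D: "\<And>i. prob_space (density (N i) (g i))"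
  shows "PiM I (\<lambda>i. density (N i) (g i)) = density (PiM I N) (\<lambda>z. \<Prod>i\<in>I. g i (z i))"
proof -
  interpret N: product_prob_space N by (intro product_prob_spaceI N)
  interpret D: product_prob_space "\<lambda>i. density (N i) (g i)" by (intro product_prob_spaceI D)
  show ?thesis
  proof (rule D.PiM_eqI[symmetric, OF I])
    show "sets (density (PiM I N) (\<lambda>z. \<Prod>i\<in>I. g i (z i))) = sets (PiM I (\<lambda>i. density (N i) (g i)))"
      by (simp cong: sets_PiM_cong)
  next
    fix A assume "\<And>i. i \<in> I \<Longrightarrow> A i \<in> sets (density (N i) (g i))"
    then have A [measurable]: "i \<in> I \<Longrightarrow> A i \<in> sets (N i)" for i by simp
    have "emeasure (density (PiM I N) (\<lambda>z. \<Prod>i\<in>I. g i (z i))) (Pi\<^sub>E I A)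
        = (\<integral>\<^sup>+z. (\<Prod>i\<in>I. g i (z i)) * indicator (Pi\<^sub>E I A) z \<partial>PiM I N)"
      using I A by (intro emeasure_density sets_PiM_I_finite) auto
    also have "\<dots> = (\<integral>\<^sup>+z. (\<Prod>i\<in>I. g i (z i) * indicator (A i) (z i)) \<partial>PiM I N)"
    proof (rule nn_integral_cong)
      fix z assume "z \<in> space (PiM I N)"
      then have "indicator (Pi\<^sub>E I A) z = (\<Prod>i\<in>I. indicator (A i) (z i) :: ennreal)"
        using I by (auto simp: indicator_def space_PiM PiE_iff prod_zero_iff)
      then show "(\<Prod>i\<in>I. g i (z i)) * indicator (Pi\<^sub>E I A) z
          = (\<Prod>i\<in>I. g i (z i) * indicator (A i) (z i))"
        by (simp add: prod.distrib)
    qed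
    also have "\<dots> = (\<Prod>i\<in>I. \<integral>\<^sup>+x. g i x * indicator (A i) x \<partial>N i)"
      by (rule N.product_nn_integral_prod[OF I]) measurable
    also have "\<dots> = (\<Prod>i\<in>I. emeasure (density (N i) (g i)) (A i))"
      by (intro prod.cong refl emeasure_density[symmetric]) auto
    finally show "emeasure (density (PiM I N) (\<lambda>z. \<Prod>i\<in>I. g i (z i))) (Pi\<^sub>E I A)
        = (\<Prod>i\<in>I. emeasure (density (N i) (g i)) (A i))" .
  qed
qed

text \<open>
  Scaling every coordinate of a standard Gaussian vector multiplies its density by a function of
  the squared norm alone, so the change of measure passes to the law of the squared norm.
\<close>

lemma chi_square_scale:
  assumes "\<sigma> > 0"
  shows "distr (chi_square k) borel (\<lambda>y. y / \<sigma>\<^sup>2)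
    = density (chi_square k) (\<lambda>y. ennreal (\<sigma> ^ k * exp (- (\<sigma>\<^sup>2 - 1) * y / 2)))"
proof -
  let ?N = std_normal_measure and ?P = "PiM {..<k} (\<lambda>_. std_normal_measure)"
  let ?Q = "\<lambda>z :: nat \<Rightarrow> real. \<Sum>i<k. (z i)\<^sup>2"
  let ?g = "\<lambda>x. ennreal (\<sigma> * exp (- (\<sigma>\<^sup>2 - 1) * x\<^sup>2 / 2))"
  have N: "prob_space ?N" by (rule prob_space_normal_density) simp
  note [measurable] = measurable_sum_squares
  have scaled: "distr ?N ?N (\<lambda>z. z / \<sigma>) = density ?N ?g"
    using std_normal_scale[OF assms] by (simp cong: distr_cong)
  have D: "prob_space (density ?N ?g)"
    by (subst scaled[symmetric], rule prob_space.prob_space_distr[OF N]) simp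
  have prod: "(\<Prod>i<k. ?g (z i)) = ennreal (\<sigma> ^ k * exp (- (\<sigma>\<^sup>2 - 1) * ?Q z / 2))" for z
    using assms by (simp add: prod_ennreal prod.distrib exp_sum[symmetric] sum_distrib_left sum_divide_distrib)
  have "distr ?P ?P (compose {..<k} (\<lambda>x. x / \<sigma>)) = PiM {..<k} (\<lambda>_. distr ?N ?N (\<lambda>z. z / \<sigma>))"
    by (rule distr_PiM_finite_prob_space') (auto intro: N)
  also have "\<dots> = density ?P (\<lambda>z. \<Prod>i<k. ?g (z i))"
    unfolding scaled by (rule PiM_density) (use N D in simp_all)
  finally have P: "distr ?P ?P (compose {..<k} (\<lambda>x. x / \<sigma>))
      = density ?P (\<lambda>z. ennreal (\<sigma> ^ k * exp (- (\<sigma>\<^sup>2 - 1) * ?Q z / 2)))"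
    by (simp only: prod)
  have "distr (chi_square k) borel (\<lambda>y. y / \<sigma>\<^sup>2) = distr ?P borel (\<lambda>z. ?Q z / \<sigma>\<^sup>2)"
    unfolding chi_square_def by (subst distr_distr) (auto simp: comp_def)
  also have "\<dots> = distr (distr ?P ?P (compose {..<k} (\<lambda>x. x / \<sigma>))) borel ?Q"
  proof -
    have [measurable]: "compose {..<k} (\<lambda>x. x / \<sigma>) \<in> measurable ?P ?P"
      unfolding compose_def by (intro measurable_restrict) auto
    show ?thesis
      by (subst distr_distr) (auto simp: comp_def compose_def power_divide sum_divide_distrib intro!: distr_cong)
  qed
  also have "\<dots> = density (chi_square k) (\<lambda>y. ennreal (\<sigma> ^ k * exp (- (\<sigma>\<^sup>2 - 1) * y / 2)))"
    unfolding P chi_square_def by (subst density_distr) auto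
  finally show ?thesis .
qed

text \<open>
  The form in which the change of measure is applied: an interval of typical values \<open>w\<close> is carried
  to the interval of the values \<open>s * w\<close>, and the price is a lower bound \<open>exp e\<close> for the density on the
  typical interval, where \<open>s\<close> is the square of the scaling factor of the Gaussian vector.
\<close>

lemma chi_square_tilt:
  assumes s: "s > 0" and e: "\<And>w. a \<le> w \<Longrightarrow> w \<le> b \<Longrightarrow> e \<le> k / 2 * ln s - (s - 1) * w / 2"
  shows "exp e * measure (chi_square k) {a..b} \<le> measure (chi_square k) {s * a..s * b}"
proof -
  interpret prob_space "chi_square k" by (rule prob_space_chi_square)
  let ?f = "\<lambda>y. exp (k / 2 * ln s - (s - 1) * y / 2)"
  have "sqrt s ^ k = exp (k / 2 * ln s)"
    using s by (simp add: powr_realpow[symmetric] powr_def ln_sqrt)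
  then have f: "sqrt s ^ k * exp (- ((sqrt s)\<^sup>2 - 1) * y / 2) = ?f y" for y
    using s by (simp add: exp_add[symmetric] algebra_simps diff_divide_distrib)
  have "ennreal (exp e * measure (chi_square k) {a..b}) = (\<integral>\<^sup>+y. ennreal (exp e) * indicator {a..b} y \<partial>chi_square k)"
    by (simp add: nn_integral_cmult emeasure_eq_measure ennreal_mult)
  also have "\<dots> \<le> (\<integral>\<^sup>+y. ennreal (?f y) * indicator {a..b} y \<partial>chi_square k)"
    using e by (intro nn_integral_mono) (auto simp: indicator_def intro!: ennreal_leI)
  also have "\<dots> = emeasure (density (chi_square k) (\<lambda>y. ennreal (?f y))) {a..b}"
    by (subst emeasure_density) (auto simp: sets_chi_square)
  also have "density (chi_square k) (\<lambda>y. ennreal (?f y)) = distr (chi_square k) borel (\<lambda>y. y / s)"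
    using chi_square_scale[of "sqrt s" k] s by (simp only: f) simp
  also have "emeasure \<dots> {a..b} = emeasure (chi_square k) {s * a..s * b}"
    using s by (subst emeasure_distr) (auto simp: field_simps intro!: arg_cong[where f="emeasure _"])
  finally show ?thesis by (simp add: emeasure_eq_measure)
qed

text \<open>
  The law of a squared norm charges no negative number. The origin is fixed by every scaling, so
  that its mass \<open>p\<close> satisfies \<open>s powr (k / 2) * p \<le> p\<close> for every \<open>s > 0\<close>; any \<open>s > 1\<close>, such as
  \<open>s = 4\<close>, forces \<open>p = 0\<close>.
\<close>

lemma chi_square_null:
  assumes "k \<ge> 1"
  shows "measure (chi_square k) {..0} = 0"
proof -
  interpret prob_space "chi_square k" by (rule prob_space_chi_square)
  have "measure (chi_square k) {..<0} = 0"
  proof -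
    have "\<not> (\<Sum>i<k. (z i)\<^sup>2) < 0" for z :: "nat \<Rightarrow> real"
      by (simp add: not_less sum_nonneg)
    then have "(\<lambda>z :: nat \<Rightarrow> real. \<Sum>i<k. (z i)\<^sup>2) -` {..<0} = {}"
      by auto
    then show ?thesis
      unfolding chi_square_def by (subst measure_distr[OF measurable_sum_squares]) auto
  qed
  moreover have "measure (chi_square k) {0} = 0"
  proof (rule ccontr)
    assume "measure (chi_square k) {0} \<noteq> 0"
    then have "exp (k / 2 * ln 4) \<le> (1 :: real)"
      using chi_square_tilt[of 4 0 0 "k / 2 * ln 4" k] measure_nonneg[of "chi_square k" "{0}"]
      by (simp add: mult_le_cancel_right1 del: measure_nonneg exp_le_one_iff)
    then show False using assms by (simp add: mult_le_0_iff)
  qed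
  moreover have "measure (chi_square k) {..0} = measure (chi_square k) {..<0} + measure (chi_square k) {0}"
    by (subst finite_measure_Union[symmetric]) (auto intro!: arg_cong[where f="measure _"])
  ultimately show ?thesis by simp
qed

section \<open>Moments up to order four\<close>

lemma (in prob_space)
  fixes X Y :: "'a \<Rightarrow> real"
  assumes indep: "indep_var borel X borel Y"
    and X: "\<And>j. integrable M (\<lambda>\<omega>. X \<omega> ^ j)" and Y: "\<And>j. integrable M (\<lambda>\<omega>. Y \<omega> ^ j)"
  shows integrable_power_add_indep: "integrable M (\<lambda>\<omega>. (X \<omega> + Y \<omega>) ^ n)"
    and expectation_power_add_indep: "expectation (\<lambda>\<omega>. (X \<omega> + Y \<omega>) ^ n)
      = (\<Sum>j\<le>n. real (n choose j) * (expectation (\<lambda>\<omega>. X \<omega> ^ j) * expectation (\<lambda>\<omega>. Y \<omega> ^ (n - j))))"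
proof -
  have ind: "indep_var borel (\<lambda>\<omega>. X \<omega> ^ i) borel (\<lambda>\<omega>. Y \<omega> ^ j)" for i j
    using indep_var_compose[OF indep, of "\<lambda>x. x ^ i" borel "\<lambda>x. x ^ j" borel] by (simp add: comp_def)
  note int = indep_var_integrable[OF ind X Y] and prod = indep_var_lebesgue_integral[OF ind X Y]
  show "integrable M (\<lambda>\<omega>. (X \<omega> + Y \<omega>) ^ n)"
    unfolding binomial_ring using int by (auto simp: mult.assoc intro!: Bochner_Integration.integrable_sum)
  show "expectation (\<lambda>\<omega>. (X \<omega> + Y \<omega>) ^ n)
      = (\<Sum>j\<le>n. real (n choose j) * (expectation (\<lambda>\<omega>. X \<omega> ^ j) * expectation (\<lambda>\<omega>. Y \<omega> ^ (n - j))))"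
    unfolding binomial_ring using int prod
    by (subst Bochner_Integration.integral_sum) (auto simp: mult.assoc)
qed

text \<open>
  Centring removes from the binomial expansion every term that contains a first moment. Hence the
  third moments cancel, and the second and fourth moments obey a closed recursion in \<open>k\<close>.
\<close>

lemma (in prob_space) moments_sum_indep_centered:
  fixes W :: "nat \<Rightarrow> 'a \<Rightarrow> real"
  assumes "indep_vars (\<lambda>_. borel) W {..<k}"
    and int: "\<And>i j. i < k \<Longrightarrow> integrable M (\<lambda>\<omega>. W i \<omega> ^ j)"
    and m1: "\<And>i. i < k \<Longrightarrow> expectation (W i) = 0"
    and m2: "\<And>i. i < k \<Longrightarrow> expectation (\<lambda>\<omega>. W i \<omega> ^ 2) = v"
    and m4: "\<And>i. i < k \<Longrightarrow> expectation (\<lambda>\<omega>. W i \<omega> ^ 4) = m"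
  shows "(\<forall>j. integrable M (\<lambda>\<omega>. (\<Sum>i<k. W i \<omega>) ^ j))
    \<and> expectation (\<lambda>\<omega>. \<Sum>i<k. W i \<omega>) = 0
    \<and> expectation (\<lambda>\<omega>. (\<Sum>i<k. W i \<omega>) ^ 2) = k * v
    \<and> expectation (\<lambda>\<omega>. (\<Sum>i<k. W i \<omega>) ^ 4) = k * m + 3 * k * (real k - 1) * v\<^sup>2"
  using assms
proof (induction k)
  case 0
  then show ?case by (auto simp: power_0_left)
next
  case (Suc k)
  let ?S = "\<lambda>\<omega>. \<Sum>i<k. W i \<omega>"
  have "indep_vars (\<lambda>_. borel) W {..<k}"
    using Suc.prems(1) by (rule indep_vars_subset) auto
  then have IH: "\<And>j. integrable M (\<lambda>\<omega>. ?S \<omega> ^ j)" "expectation ?S = 0"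
      "expectation (\<lambda>\<omega>. ?S \<omega> ^ 2) = k * v"
      "expectation (\<lambda>\<omega>. ?S \<omega> ^ 4) = k * m + 3 * k * (real k - 1) * v\<^sup>2"
    using Suc by auto
  have "indep_var borel (W k) borel ?S"
    using Suc.prems(1) by (intro indep_vars_sum) (auto simp: lessThan_Suc)
  note add = this Suc.prems(2)[OF lessI] IH(1)
  have 1: "expectation (\<lambda>\<omega>. W k \<omega> + ?S \<omega>) = 0"
    using expectation_power_add_indep[OF add, of 1] IH(2) Suc.prems(3) by (simp add: prob_space)
  have 2: "expectation (\<lambda>\<omega>. (W k \<omega> + ?S \<omega>) ^ 2) = v + k * v"
    using expectation_power_add_indep[OF add, of 2] IH(2,3) Suc.prems(3,4)
    by (simp add: prob_space atMost_Suc numeral_eq_Suc)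
  have 4: "expectation (\<lambda>\<omega>. (W k \<omega> + ?S \<omega>) ^ 4)
      = m + 6 * v * (k * v) + (k * m + 3 * k * (real k - 1) * v\<^sup>2)"
    using expectation_power_add_indep[OF add, of 4] IH(2-4) Suc.prems(3-5)
    by (simp add: prob_space atMost_Suc numeral_eq_Suc)
  show ?case
    using integrable_power_add_indep[OF add] 1 2 4
    by (simp add: add.commute algebra_simps power2_eq_square)
qed


text \<open>
  The summands \<open>(z i)\<^sup>2 - 1\<close> are centred, have variance 2 and fourth moment
  \<open>105 - 4 * 15 + 6 * 3 - 4 + 1 = 60\<close>, by the even Gaussian moments 1, 3, 15 and 105.
\<close>

lemma chi_square_moments:
  assumes "k \<ge> 1"
  shows "integrable (chi_square k) (\<lambda>y. (y - real k) ^ j)"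
    and "(\<integral>y. (y - real k) \<partial>chi_square k) = 0"
    and "(\<integral>y. (y - real k) ^ 2 \<partial>chi_square k) = 2 * real k"
    and "(\<integral>y. (y - real k) ^ 4 \<partial>chi_square k) = 12 * (real k)\<^sup>2 + 48 * real k"
proof -
  let ?N = std_normal_measure and ?P = "PiM {..<k} (\<lambda>_. std_normal_measure)"
  have N: "prob_space ?N" by (rule prob_space_normal_density) simp
  interpret P: prob_space ?P by (intro prob_space_PiM N)
  note [measurable] = measurable_sum_squares
  define W where "W = (\<lambda>i (z :: nat \<Rightarrow> real). (z i)\<^sup>2 - 1)"
  have comp: "distr ?P ?N (\<lambda>z. z i) = ?N" if "i < k" for i
    using that by (intro distr_PiM_component N) auto
  have pow: "has_bochner_integral ?N (\<lambda>x. x ^ (2 * j)) (fact (2 * j) / (2 ^ j * fact j))" for j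
    using std_normal_moment_even[of j] by (subst has_bochner_integral_density) auto
  have powi: "integrable ?N (\<lambda>x. x ^ (2 * j))" for j
    using pow[of j] by (auto simp: has_bochner_integral_iff)
  have binom: "(x\<^sup>2 - 1) ^ j = (\<Sum>l\<le>j. of_nat (j choose l) * x ^ (2 * l) * (-1) ^ (j - l))" for x :: real and j
    using binomial_ring[of "x\<^sup>2" "-1" j] by (simp add: power_mult)
  have int1: "integrable ?N (\<lambda>x. (x\<^sup>2 - 1) ^ j)" for j
    unfolding binom using powi by auto
  have mom: "(\<integral>x. (x\<^sup>2 - 1) ^ j \<partial>?N) = (\<Sum>l\<le>j. of_nat (j choose l) * (fact (2 * l) / (2 ^ l * fact l)) * (-1) ^ (j - l))" for j
    unfolding binom using powi has_bochner_integral_integral_eq[OF pow]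
    by (subst Bochner_Integration.integral_sum) auto
  have W_int: "integrable ?P (\<lambda>z. W i z ^ j)" if "i < k" for i j
    unfolding W_def using that int1[of j] 
    by (subst (asm) comp[symmetric, OF that], subst (asm) integrable_distr_eq) auto
  have W_mom: "(\<integral>z. W i z ^ j \<partial>?P) = (\<integral>x. (x\<^sup>2 - 1) ^ j \<partial>?N)" if "i < k" for i j
    unfolding W_def using that
    by (subst (2) comp[symmetric, OF that], subst integral_distr) auto
  have coord: "P.indep_vars (\<lambda>_. ?N) (\<lambda>i z. z i) {..<k}"
  proof (subst P.indep_vars_iff_distr_eq_PiM')
    show "distr ?P ?P (\<lambda>z. \<lambda>i\<in>{..<k}. z i) = PiM {..<k} (\<lambda>i. distr ?P ?N (\<lambda>z. z i))"
      by (subst PiM_cong[OF refl comp], simp, subst distr_cong[OF refl refl, of _ _ "\<lambda>x. x"])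
        (auto simp: space_PiM PiE_iff extensional_restrict distr_id)
  qed (use assms in \<open>auto simp: lessThan_empty_iff\<close>)
  have indep: "P.indep_vars (\<lambda>_. borel) W {..<k}"
    unfolding W_def by (rule P.indep_vars_compose2[OF coord]) auto
  have S: "(\<Sum>i<k. W i z) = (\<Sum>i<k. (z i)\<^sup>2) - k" for z
    by (simp add: W_def sum_subtractf)
  have M: "(\<forall>j. integrable ?P (\<lambda>z. (\<Sum>i<k. W i z) ^ j))
    \<and> (\<integral>z. (\<Sum>i<k. W i z) \<partial>?P) = 0
    \<and> (\<integral>z. (\<Sum>i<k. W i z) ^ 2 \<partial>?P) = real k * 2
    \<and> (\<integral>z. (\<Sum>i<k. W i z) ^ 4 \<partial>?P) = real k * 60 + 3 * real k * (real k - 1) * 2\<^sup>2"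
  proof (rule P.moments_sum_indep_centered[of W k 2 60])
    fix i assume "i < k"
    show "P.expectation (W i) = 0"
      using W_mom[OF \<open>i < k\<close>, of 1] unfolding mom by simp
    show "(\<integral>z. W i z ^ 2 \<partial>?P) = 2"
      unfolding W_mom[OF \<open>i < k\<close>] mom by (simp add: atMost_Suc numeral_eq_Suc fact_numeral)
    show "(\<integral>z. W i z ^ 4 \<partial>?P) = 60"
      unfolding W_mom[OF \<open>i < k\<close>] mom by (simp add: atMost_Suc numeral_eq_Suc fact_numeral)
  qed (use indep W_int in auto)
  show "integrable (chi_square k) (\<lambda>y. (y - real k) ^ j)"
    unfolding chi_square_def using M by (subst integrable_distr_eq) (auto simp: S)
  show "(\<integral>y. (y - real k) \<partial>chi_square k) = 0" "(\<integral>y. (y - real k) ^ 2 \<partial>chi_square k) = 2 * real k"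
      "(\<integral>y. (y - real k) ^ 4 \<partial>chi_square k) = 12 * (real k)\<^sup>2 + 48 * real k"
    unfolding chi_square_def using M
    by (subst integral_distr; force simp: S power2_eq_square algebra_simps)+
qed

section \<open>Mass within a few standard deviations on either side of the mean\<close>

text \<open>
  A variant of the second moment method that keeps track of the sign. The quartic
  \<open>v * (T - v) * (v + T / 2)\<^sup>2\<close> is positive only on the window between \<open>0\<close> and \<open>T\<close>, where it is at most
  \<open>9 / 16 * T ^ 4\<close>, so its expectation bounds the probability of the window from below. The double
  root is placed at \<open>- T / 2\<close> because there the coefficient of \<open>v ^ 3\<close> vanishes, so that the
  third moment, which changes sign with \<open>V\<close>, drops out and the estimate applies equally to \<open>V\<close> and to \<open>- V\<close>.
\<close>

lemma (in prob_space) prob_one_sided_window: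
  fixes V :: "'a \<Rightarrow> real"
  assumes int: "\<And>j. integrable M (\<lambda>\<omega>. V \<omega> ^ j)"
    and m1: "expectation V = 0" and m2: "expectation (\<lambda>\<omega>. V \<omega> ^ 2) = v"
    and m4: "expectation (\<lambda>\<omega>. V \<omega> ^ 4) \<le> B"
    and T: "T > 0"
  shows "3 / 4 * T\<^sup>2 * v - B \<le> 9 / 16 * T ^ 4 * prob {\<omega>\<in>space M. 0 \<le> V \<omega> \<and> V \<omega> \<le> T}"
proof -
  have [measurable]: "V \<in> borel_measurable M" using int[of 1] by auto
  let ?A = "{\<omega>\<in>space M. 0 \<le> V \<omega> \<and> V \<omega> \<le> T}"
  define q where "q = (\<lambda>v::real. v * (T - v) * (v + T / 2)\<^sup>2)"
  have q_eq: "q v = T ^ 3 / 4 * v + 3 / 4 * T\<^sup>2 * v ^ 2 - v ^ 4" for v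
    unfolding q_def by (simp add: power2_eq_square power3_eq_cube power4_eq_xxxx field_simps)
  have q_le: "q v \<le> 9 / 16 * T ^ 4 * indicator {0..T} v" for v
  proof (cases "v \<in> {0..T}")
    case True
    have "v * (T - v) \<le> T\<^sup>2 / 4"
      using sum_squares_ge_zero[of "v - T / 2" 0] by (simp add: power2_eq_square algebra_simps)
    moreover have "(v + T / 2)\<^sup>2 \<le> (3 / 2 * T)\<^sup>2" using True T by (intro power_mono) auto
    ultimately have "q v \<le> T\<^sup>2 / 4 * (3 / 2 * T)\<^sup>2"
      unfolding q_def using True by (intro mult_mono) auto
    then show ?thesis using True by (simp add: power2_eq_square power4_eq_xxxx)
  next
    case False
    then have "v * (T - v) \<le> 0" using T by (auto simp: mult_le_0_iff)
    then show ?thesis using False unfolding q_def by (auto simp: mult_nonpos_nonneg)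
  qed
  note i = int[of 1, simplified] int[of 2] int[of 4]
  have lower: "expectation (\<lambda>\<omega>. q (V \<omega>)) = 3 / 4 * T\<^sup>2 * v - expectation (\<lambda>\<omega>. V \<omega> ^ 4)"
    unfolding q_eq using i m1 m2 by simp
  have "expectation (\<lambda>\<omega>. q (V \<omega>)) \<le> expectation (\<lambda>\<omega>. 9 / 16 * T ^ 4 * indicator ?A \<omega>)"
  proof (rule integral_mono)
    show "integrable M (\<lambda>\<omega>. q (V \<omega>))" unfolding q_eq using i by simp
    show "q (V \<omega>) \<le> 9 / 16 * T ^ 4 * indicator ?A \<omega>" if "\<omega> \<in> space M" for \<omega>
      using q_le[of "V \<omega>"] that by (simp add: indicator_def)
    have "integrable M (indicator ?A :: 'a \<Rightarrow> real)"
      by (rule integrable_real_indicator) (auto simp: emeasure_eq_measure)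
    then show "integrable M (\<lambda>\<omega>. 9 / 16 * T ^ 4 * indicator ?A \<omega>)" by simp
  qed
  also have "\<dots> = 9 / 16 * T ^ 4 * prob ?A" by simp
  finally show ?thesis using m4 unfolding lower by linarith
qed


text \<open>
  With \<open>V = Y - k\<close> or \<open>V = k - Y\<close> the second moment is \<open>2 * k\<close> and the fourth is at most
  \<open>60 * k\<^sup>2\<close>. For \<open>T = 8 * sqrt k\<close> the preceding bound reads \<open>36 * k\<^sup>2 \<le> 2304 * k\<^sup>2 * p\<close>, and
  \<open>36 / 2304 = 1 / 64\<close>. The factor 8 makes the left-hand side positive for every \<open>k \<ge> 1\<close>.
\<close>

lemma chi_square_window:
  assumes "k \<ge> 1"
  shows "1 / 64 \<le> measure (chi_square k) {real k..k + 8 * sqrt k}"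
    and "1 / 64 \<le> measure (chi_square k) {k - 8 * sqrt k..real k}"
proof -
  interpret prob_space "chi_square k" by (rule prob_space_chi_square)
  note mom = chi_square_moments[OF assms]
  have k: "real k \<ge> 1" using assms by simp
  have window: "1 / 64 \<le> measure (chi_square k) {y. 0 \<le> V y \<and> V y \<le> 8 * sqrt k}"
    if V: "V = (\<lambda>y. y - real k) \<or> V = (\<lambda>y. - (y - real k))" for V :: "real \<Rightarrow> real"
  proof -
    have pow: "integrable (chi_square k) (\<lambda>y. V y ^ j)" for j
      using V mom(1)[of j] by (auto simp: power_minus[of "_ - real k"] simp del: minus_diff_eq)
    have "(\<integral>y. V y \<partial>chi_square k) = 0"
      using V mom(2) by (auto simp del: minus_diff_eq)
    moreover have "V y ^ 2 = (y - k) ^ 2" "V y ^ 4 = (y - k) ^ 4" for y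
      using V by (auto simp: power2_commute power_even_eq[of _ 2, simplified] simp del: minus_diff_eq)
    moreover have "12 * real k ^ 2 + 48 * real k \<le> 60 * real k ^ 2"
      using k by (simp add: power2_eq_square)
    ultimately have "3 / 4 * (8 * sqrt k)\<^sup>2 * (2 * k) - 60 * real k ^ 2 \<le> 9 / 16 * (8 * sqrt k) ^ 4 *
        measure (chi_square k) {y \<in> space (chi_square k). 0 \<le> V y \<and> V y \<le> 8 * sqrt k}"
      using k mom(3,4) by (intro prob_one_sided_window pow) auto
    then have "36 * real k ^ 2 \<le> 2304 * real k ^ 2 * measure (chi_square k) {y. 0 \<le> V y \<and> V y \<le> 8 * sqrt k}"
      by (simp add: power_mult_distrib power4_eq_xxxx power2_eq_square flip: mult.assoc)
    then show ?thesis using k by (simp add: field_simps)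
  qed
  show "1 / 64 \<le> measure (chi_square k) {real k..k + 8 * sqrt k}"
    using window[of "\<lambda>y. y - k"] by (auto elim!: order_trans intro!: finite_measure_mono)
  show "1 / 64 \<le> measure (chi_square k) {k - 8 * sqrt k..real k}"
    using window[of "\<lambda>y. - (y - k)"] by (auto elim!: order_trans intro!: finite_measure_mono)
qed

section \<open>Tail bounds\<close>

lemma ln_add_one_lower:
  fixes u :: real
  assumes "u \<ge> 0"
  shows "u - min u (u\<^sup>2) \<le> ln (1 + u)"
proof (cases "u \<le> 1")
  case True
  then show ?thesis
    using ln_one_plus_pos_lower_bound[of u] assms mult_left_le[of u u] by (simp add: power2_eq_square)
next
  case False
  then have "u \<le> u\<^sup>2" by (simp add: power2_eq_square)
  then show ?thesis using assms by simp
qed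

lemma ln_one_minus_lower:
  fixes u :: real
  assumes "u < 1"
  shows "- u - u\<^sup>2 / (1 - u) \<le> ln (1 - u)"
proof -
  have "ln (1 / (1 - u)) \<le> 1 / (1 - u) - 1"
    using assms by (intro ln_le_minus_one) auto
  moreover have "1 / (1 - u) - 1 = u + u\<^sup>2 / (1 - u)"
    using assms by (simp add: field_simps power2_eq_square)
  ultimately show ?thesis using assms by (simp add: ln_div)
qed

text \<open>
  The width \<open>8 * sqrt K\<close> of the typical window adds a multiple of \<open>x / sqrt K\<close> to the exponent. Up
  to an additive constant, which goes into the prefactor, it is absorbed by \<open>x\<^sup>2 / K\<close> as well as by \<open>x\<close>.
\<close>

lemma div_sqrt_le:
  fixes x K :: real
  assumes "K \<ge> 1" "x \<ge> 0"
  shows "x / sqrt K \<le> 1 + x\<^sup>2 / K" "x / sqrt K \<le> x"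
proof -
  have "x / sqrt K \<le> 1 + (x / sqrt K)\<^sup>2"
    using sum_squares_ge_zero[of "x / sqrt K - 1 / 2" 0] by (simp add: power2_eq_square algebra_simps)
  then show "x / sqrt K \<le> 1 + x\<^sup>2 / K" using assms by (simp add: power_divide)
  show "x / sqrt K \<le> x" using assms by (simp add: divide_le_eq mult_le_cancel_left1)
qed

text \<open>
  The factor \<open>s = 1 + x / k\<close> carries \<open>k\<close> to \<open>k + x\<close>. In the exponent the first-order terms of
  \<open>k / 2 * ln s\<close> and \<open>(s - 1) * k / 2\<close> cancel. What remains is at least \<open>- m / 2\<close> for
  \<open>m = min x (x\<^sup>2 / k)\<close> from the logarithm, and at least \<open>- 4 * (1 + m)\<close> from the width of the window.
\<close>

lemma chi_square_upper_tail:
  assumes "k \<ge> 1" "x > 0"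
  shows "exp (- 4) / 64 * exp (- 5 * min x (x\<^sup>2 / k)) \<le> measure (chi_square k) {y. y - k \<ge> x}"
proof -
  interpret prob_space "chi_square k" by (rule prob_space_chi_square)
  have k: "real k \<ge> 1" using assms by simp
  define u where "u = x / k"
  let ?m = "min x (x\<^sup>2 / k)"
  have u: "u > 0" using assms by (simp add: u_def)
  have ku: "k * u = x" "k * min u (u\<^sup>2) = ?m"
    using k by (auto simp: u_def min_mult_distrib_left power2_eq_square)
  have "exp (- 4 - 5 * ?m) * measure (chi_square k) {real k..k + 8 * sqrt k}
      \<le> measure (chi_square k) {(1 + u) * k..(1 + u) * (k + 8 * sqrt k)}"
  proof (rule chi_square_tilt)
    fix w assume w: "w \<le> k + 8 * sqrt k"
    have "u * w \<le> u * (k + 8 * sqrt k)" using w u by (intro mult_left_mono) auto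
    also have "\<dots> = x + 8 * (x / sqrt k)"
      using k by (simp add: u_def field_simps real_sqrt_mult[symmetric])
    also have "\<dots> \<le> x + 8 * (1 + ?m)"
      using div_sqrt_le[of k x] k assms by (auto simp: min_def)
    finally have 1: "u * w / 2 \<le> x / 2 + 4 + 4 * ?m" by simp
    have "k * (u - min u (u\<^sup>2)) \<le> k * ln (1 + u)"
      using ln_add_one_lower[of u] u by (intro mult_left_mono) auto
    then have 2: "x - ?m \<le> k * ln (1 + u)" by (simp add: right_diff_distrib ku)
    have "?m \<ge> 0" using assms by simp
    with 1 2 have "- 4 - 5 * ?m \<le> k * ln (1 + u) / 2 - u * w / 2" by linarith
    then show "- 4 - 5 * ?m \<le> k / 2 * ln (1 + u) - (1 + u - 1) * w / 2" by simp
  qed (use u in auto)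
  also have "\<dots> \<le> measure (chi_square k) {y. y - k \<ge> x}"
    using ku by (intro finite_measure_mono) (auto simp: algebra_simps)
  also have "exp (- 4 - 5 * ?m) * (1 / 64) \<le> exp (- 4 - 5 * ?m) * measure (chi_square k) {real k..k + 8 * sqrt k}"
    using chi_square_window(1)[OF assms(1)] by (intro mult_left_mono) auto
  finally show ?thesis by (simp add: exp_diff exp_minus field_simps)
qed

text \<open>
  The factor \<open>s = 1 - x / k\<close> carries \<open>k\<close> to \<open>k - x\<close>, starting now from the window to the left of \<open>k\<close>.
  The first-order terms cancel as for the upper tail, but the remainder of the logarithm is
  controlled by \<open>u\<^sup>2 / (1 - u)\<close> with \<open>u = x / k\<close>. This is where \<open>u < 1 - \<epsilon>\<close> is used, and why the
  constant grows like \<open>1 / \<epsilon>\<close>.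
\<close>

lemma chi_square_lower_tail:
  assumes "k \<ge> 1" "0 < \<epsilon>" "0 < x" "x < (1 - \<epsilon>) * k"
  shows "exp (- 4) / 64 * exp (- (1 / (2 * \<epsilon>) + 4) * x\<^sup>2 / k) \<le> measure (chi_square k) {y. y - k \<le> - x}"
proof -
  interpret prob_space "chi_square k" by (rule prob_space_chi_square)
  have k: "real k \<ge> 1" using assms by simp
  define u where "u = x / k"
  let ?m = "x\<^sup>2 / k"
  have u: "u > 0" "u < 1 - \<epsilon>" using assms k by (auto simp: u_def field_simps)
  have ku: "k * u = x" "k * u\<^sup>2 = ?m"
    using k by (auto simp: u_def power2_eq_square)
  have "exp (- 4 - (1 / (2 * \<epsilon>) + 4) * ?m) * measure (chi_square k) {k - 8 * sqrt k..real k}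
      \<le> measure (chi_square k) {(1 - u) * (k - 8 * sqrt k)..(1 - u) * k}"
  proof (rule chi_square_tilt)
    fix w assume w: "k - 8 * sqrt k \<le> w"
    have "x - 8 * (1 + ?m) \<le> x - 8 * (x / sqrt k)"
      using div_sqrt_le[of k x] k assms by auto
    also have "\<dots> = u * (k - 8 * sqrt k)"
      using k by (simp add: u_def field_simps real_sqrt_mult[symmetric])
    also have "\<dots> \<le> u * w" using w u by (intro mult_left_mono) auto
    finally have 1: "x / 2 - 4 - 4 * ?m \<le> u * w / 2" by simp
    have "u\<^sup>2 / (1 - u) \<le> u\<^sup>2 / \<epsilon>" using u assms by (intro divide_left_mono) auto
    then have "- u - u\<^sup>2 / \<epsilon> \<le> ln (1 - u)"
      using ln_one_minus_lower[of u] u assms by simp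
    then have "k * (- u - u\<^sup>2 / \<epsilon>) \<le> k * ln (1 - u)"
      by (intro mult_left_mono) auto
    then have "- (k * u) - k * u\<^sup>2 / \<epsilon> \<le> k * ln (1 - u)" by (simp add: algebra_simps)
    then have 2: "- x / 2 - 1 / (2 * \<epsilon>) * ?m \<le> k / 2 * ln (1 - u)"
      unfolding ku by (simp add: mult.commute)
    have "- 4 - (1 / (2 * \<epsilon>) + 4) * ?m = (x / 2 - 4 - 4 * ?m) + (- x / 2 - 1 / (2 * \<epsilon>) * ?m)"
      unfolding distrib_right by linarith
    also have "\<dots> \<le> u * w / 2 + k / 2 * ln (1 - u)" by (rule add_mono[OF 1 2])
    finally show "- 4 - (1 / (2 * \<epsilon>) + 4) * ?m \<le> k / 2 * ln (1 - u) - (1 - u - 1) * w / 2" by simp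
  qed (use u assms in auto)
  also have "\<dots> \<le> measure (chi_square k) {y. y - k \<le> - x}"
    using ku by (intro finite_measure_mono) (auto simp: algebra_simps)
  also have "exp (- 4 - (1 / (2 * \<epsilon>) + 4) * ?m) * (1 / 64)
      \<le> exp (- 4 - (1 / (2 * \<epsilon>) + 4) * ?m) * measure (chi_square k) {k - 8 * sqrt k..real k}"
    using chi_square_window(2)[OF assms(1)] by (intro mult_left_mono) auto
  also have "exp (- 4 - (1 / (2 * \<epsilon>) + 4) * ?m) * (1 / 64)
      = exp (- 4) / 64 * exp (- (1 / (2 * \<epsilon>) + 4) * x\<^sup>2 / k)"
  proof -
    have "- 4 - D * ?m = - 4 + - D * x\<^sup>2 / k" for D by simp
    then show ?thesis by (simp only: exp_add)
  qed
  finally show ?thesis .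
qed

theorem corollary3:
  shows "\<exists>C>0::real. \<exists>c>0::real. \<forall>\<epsilon>::real. 0 < \<epsilon> \<and> \<epsilon> < 1 \<longrightarrow> (\<exists>C\<^sub>\<epsilon>>0::real. \<forall>k::nat. 1 \<le> k \<longrightarrow>
      (\<forall>x::real. 0 < x \<longrightarrow>
        \<P>(Y in chi_square k. Y - real k \<ge> x) \<ge> c * exp (- C * min x (x\<^sup>2 / real k))) \<and>
      (\<forall>x::real. 0 < x \<and> x < (1 - \<epsilon>) * real k \<longrightarrow>
        \<P>(Y in chi_square k. Y - real k \<le> - x) \<ge> c * exp (- C\<^sub>\<epsilon> * x\<^sup>2 / real k)) \<and>
      (\<forall>x::real. x \<ge> real k \<longrightarrow>
        \<P>(Y in chi_square k. Y - real k \<le> - x) = 0))"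
proof (rule exI[of _ 5], rule conjI, simp, rule exI[of _ "exp (- 4) / 64"], rule conjI, simp,
    intro allI impI, goal_cases)
  case (1 \<epsilon>)
  show ?case
  proof (rule exI[of _ "1 / (2 * \<epsilon>) + 4"], intro conjI allI impI)
    show "1 / (2 * \<epsilon>) + 4 > 0" using 1 by (simp add: add_pos_pos)
  next
    fix k :: nat and x :: real assume "1 \<le> k" "0 < x"
    then show "\<P>(Y in chi_square k. Y - real k \<ge> x) \<ge> exp (- 4) / 64 * exp (- 5 * min x (x\<^sup>2 / real k))"
      using chi_square_upper_tail[of k x] by simp
  next
    fix k :: nat and x :: real assume "1 \<le> k" "0 < x \<and> x < (1 - \<epsilon>) * real k"
    then show "\<P>(Y in chi_square k. Y - real k \<le> - x) \<ge> exp (- 4) / 64 * exp (- (1 / (2 * \<epsilon>) + 4) * x\<^sup>2 / real k)"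
      using chi_square_lower_tail[of k \<epsilon> x] 1 by simp
  next
    fix k :: nat and x :: real assume k: "1 \<le> k" and "real k \<le> x"
    interpret prob_space "chi_square k" by (rule prob_space_chi_square)
    have "\<P>(Y in chi_square k. Y - real k \<le> - x) \<le> measure (chi_square k) {..0}"
      using \<open>real k \<le> x\<close> by (intro finite_measure_mono) auto
    then show "\<P>(Y in chi_square k. Y - real k \<le> - x) = 0"
      using chi_square_null[OF k] measure_nonneg[of "chi_square k"] by (simp add: antisym)
  qed
qed

end
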